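(* The function $$u\,=\,\frac{1}{i\pi}\,\frac{E_4''}{E_4'}\,-\,E_2$$ on $\mathcal H$ is a solution to the Riccati equation $$\frac{1}{i\pi}\,u'\,+\,u^2\,=\,E_4.$$
   Context: $\mathcal H=\{z\in\mathbb C:\Im z>0\}$ is the upper half-plane, and $'$ denotes $d/dz$. With $q=e^{2\pi i z}$, the Eisenstein series are $E_2(z)=1-24\sum_{n\ge1}\sigma_1(n)q^n$ and $E_4(z)=1+240\sum_{n\ge1}\sigma_3(n)q^n$, where $\sigma_k(n)$ is the sum of the $k$-th powers of the positive divisors of $n$. The function $u$ is meromorphic on $\mathcal H$, and the equation is understood as an identity of meromorphic functions on $\mathcal H$. *)

theory Defs
  imports "HOL-Complex_Analysis.Complex_Analysis"
begin

definition upper_half_plane :: "complex set" where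
  "upper_half_plane = {z. Im z > 0}"

definition divisor_sum :: "nat \<Rightarrow> nat \<Rightarrow> nat" where
  "divisor_sum k n = (\<Sum>d | d dvd n. d ^ k)"

definition nome :: "complex \<Rightarrow> complex" where
  "nome z = exp (2 * of_real pi * \<i> * z)"

(* The sums over n \<ge> 1 are shifted to n \<ge> 0; they are meaningful only for Im z > 0. *)

definition E2 :: "complex \<Rightarrow> complex" where
  "E2 z = 1 - 24 * (\<Sum>n. of_nat (divisor_sum 1 (Suc n)) * nome z ^ Suc n)"

definition E4 :: "complex \<Rightarrow> complex" where
  "E4 z = 1 + 240 * (\<Sum>n. of_nat (divisor_sum 3 (Suc n)) * nome z ^ Suc n)"

(* At the zeros of deriv E4 the value is junk (x / 0 = 0), so identities involving
   riccati_u are to be read as identities of meromorphic functions, i.e. on cosparse sets. *)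

definition riccati_u :: "complex \<Rightarrow> complex" where
  "riccati_u z = 1 / (\<i> * of_real pi) * (deriv (deriv E4) z / deriv E4 z) - E2 z"

end

theory Submission
  imports Defs
begin

text \<open>
  Let \<open>D = q d/dq\<close>, and let \<open>P\<close>, \<open>Q\<close>, \<open>R\<close> be the \<open>q\<close>-series of \<open>E\<^sub>2\<close>, \<open>E\<^sub>4\<close>, \<open>E\<^sub>6\<close>.
  Then \<open>u = 2 D\<^sup>2Q / DQ - P\<close>, and by Ramanujan's \<open>12 DP = P\<^sup>2 - Q\<close> the Riccati equation becomes
  \<open>2 D\<^sup>3Q - 2 P D\<^sup>2Q + 5 DP DQ = 0\<close>. That follows by differentiating Ramanujan's three
  identities, the other two being \<open>3 DQ = P Q - R\<close> and \<open>2 DR = P R - Q\<^sup>2\<close>. They are derived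
  without modularity from convolution identities for divisor sums: the substitution
  \<open>(a, b, x, y) \<mapsto> (a - b, b, x, x + y)\<close> maps the positive solutions of \<open>a x + b y = n\<close> with
  \<open>a > b\<close> onto those with \<open>x < y\<close>, and summing suitable polynomials in \<open>a\<close> and \<open>b\<close> over both
  sides evaluates \<open>\<Sum> \<sigma>\<^sub>j(i) \<sigma>\<^sub>k(n - i)\<close> for \<open>(j, k) = (1, 1), (1, 3), (3, 3), (1, 5)\<close>.
\<close>

section \<open>Sums over representations by a bilinear form\<close>

definition bilinear_reps :: "nat \<Rightarrow> (nat \<times> nat \<times> nat \<times> nat) set" where
  "bilinear_reps n = {(a, b, x, y). 0 < a \<and> 0 < b \<and> 0 < x \<and> 0 < y \<and> a * x + b * y = n}"

lemma finite_bilinear_reps: "finite (bilinear_reps n)"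
proof (rule finite_subset)
  show "bilinear_reps n \<subseteq> {..n} \<times> {..n} \<times> {..n} \<times> {..n}"
  proof
    fix z assume "z \<in> bilinear_reps n"
    then obtain a b x y where z: "z = (a, b, x, y)" and pos: "0 < a" "0 < b" "0 < x" "0 < y"
      and n: "a * x + b * y = n"
      by (auto simp: bilinear_reps_def)
    have "a \<le> a * x" "x \<le> a * x" "b \<le> b * y" "y \<le> b * y"
      using pos by auto
    hence "a \<le> n" "b \<le> n" "x \<le> n" "y \<le> n"
      unfolding n [symmetric] by linarith+
    thus "z \<in> {..n} \<times> {..n} \<times> {..n} \<times> {..n}"
      by (simp add: z)
  qed
qed auto

lemma bilinear_reps_0: "bilinear_reps 0 = {}"
  by (auto simp: bilinear_reps_def)

text \<open>Since \<open>a * x + b * y = (a - b) * x + b * (x + y)\<close>, the two tuple maps are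
  mutually inverse between the index sets; in the new coordinates the old \<open>a\<close> reads
  \<open>a + b\<close>.\<close>

lemma sum_bilinear_reps_shift_first:
  fixes p :: "nat \<Rightarrow> nat \<Rightarrow> 'a :: comm_monoid_add"
  shows "(\<Sum>(a, b, x, y) \<in> {(a, b, x, y) \<in> bilinear_reps n. b < a}. p a b) =
         (\<Sum>(a, b, x, y) \<in> {(a, b, x, y) \<in> bilinear_reps n. x < y}. p (a + b) b)"
  by (rule sum.reindex_bij_witness[where i = "\<lambda>(a, b, x, y). (a + b, b, x, y - x)"
        and j = "\<lambda>(a, b, x, y). (a - b, b, x, x + y)"])
     (auto simp: bilinear_reps_def algebra_simps dest!: less_imp_Suc_add)

lemma sum_bilinear_reps_shift_second:
  fixes p :: "nat \<Rightarrow> nat \<Rightarrow> 'a :: comm_monoid_add"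
  shows "(\<Sum>(a, b, x, y) \<in> {(a, b, x, y) \<in> bilinear_reps n. a < b}. p a b) =
         (\<Sum>(a, b, x, y) \<in> {(a, b, x, y) \<in> bilinear_reps n. y < x}. p a (a + b))"
  by (rule sum.reindex_bij_witness[where i = "\<lambda>(a, b, x, y). (a, a + b, x - y, y)"
        and j = "\<lambda>(a, b, x, y). (a, b - a, x + y, y)"])
     (auto simp: bilinear_reps_def algebra_simps dest!: less_imp_Suc_add)

lemma sum_split_trichotomy:
  fixes f :: "'b \<Rightarrow> 'a :: comm_monoid_add" and u v :: "'b \<Rightarrow> nat"
  assumes "finite A"
  shows "sum f A = sum f {z \<in> A. u z < v z} + sum f {z \<in> A. v z < u z} + sum f {z \<in> A. u z = v z}"
proof -
  have "A = ({z \<in> A. u z < v z} \<union> {z \<in> A. v z < u z}) \<union> {z \<in> A. u z = v z}"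
    by auto
  also have "sum f \<dots> = sum f ({z \<in> A. u z < v z} \<union> {z \<in> A. v z < u z}) + sum f {z \<in> A. u z = v z}"
    using assms by (intro sum.union_disjoint) auto
  also have "sum f ({z \<in> A. u z < v z} \<union> {z \<in> A. v z < u z}) =
      sum f {z \<in> A. u z < v z} + sum f {z \<in> A. v z < u z}"
    using assms by (intro sum.union_disjoint) auto
  finally show ?thesis .
qed

text \<open>Split the first sum by comparing \<open>a\<close> with \<open>b\<close> and the second
  by comparing \<open>x\<close> with \<open>y\<close>: the two shifts match the off-diagonal pieces,
  so only the diagonals survive.\<close>

lemma sum_bilinear_reps_invariant:
  fixes p :: "nat \<Rightarrow> nat \<Rightarrow> 'a :: ab_group_add"
  assumes sym: "\<And>a b. p a b = p b a" and refl: "\<And>a b. p (a + b) b = p (a + b) a"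
  shows "(\<Sum>(a, b, x, y) \<in> bilinear_reps n. p a b)
      - (\<Sum>(a, b, x, y) \<in> bilinear_reps n. p (a + b) b) =
         (\<Sum>(a, b, x, y) \<in> {(a, b, x, y) \<in> bilinear_reps n. a = b}. p a b) -
         (\<Sum>(a, b, x, y) \<in> {(a, b, x, y) \<in> bilinear_reps n. x = y}. p (a + b) b)"
proof -
  let ?N = "bilinear_reps n"
  \<comment> \<open>The two symmetries together turn the summand produced by the second shift into
    that of the first.\<close>
  have "p a (a + b) = p (a + b) b" for a b
    by (simp add: sym[of a] refl)
  note second = sum_bilinear_reps_shift_second[of p n, unfolded this]
  have 1: "(\<Sum>(a, b, x, y) \<in> ?N. p a b) =
      (\<Sum>(a, b, x, y) \<in> {(a, b, x, y) \<in> ?N. a < b}. p a b) +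
      (\<Sum>(a, b, x, y) \<in> {(a, b, x, y) \<in> ?N. b < a}. p a b) +
      (\<Sum>(a, b, x, y) \<in> {(a, b, x, y) \<in> ?N. a = b}. p a b)"
    using sum_split_trichotomy[OF finite_bilinear_reps[of n],
        of "\<lambda>(a,b,x,y). p a b" "\<lambda>(a,b,x,y). a" "\<lambda>(a,b,x,y). b"]
    by (simp add: case_prod_unfold)
  have 2: "(\<Sum>(a, b, x, y) \<in> ?N. p (a + b) b) =
      (\<Sum>(a, b, x, y) \<in> {(a, b, x, y) \<in> ?N. x < y}. p (a + b) b) +
      (\<Sum>(a, b, x, y) \<in> {(a, b, x, y) \<in> ?N. y < x}. p (a + b) b) +
      (\<Sum>(a, b, x, y) \<in> {(a, b, x, y) \<in> ?N. x = y}. p (a + b) b)"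
    using sum_split_trichotomy[OF finite_bilinear_reps[of n],
        of "\<lambda>(a,b,x,y). p (a + b) b" "\<lambda>(a,b,x,y). x" "\<lambda>(a,b,x,y). y"]
    by (simp add: case_prod_unfold)
  show ?thesis
    unfolding 1 2 sum_bilinear_reps_shift_first[of p n] second by (simp add: algebra_simps)
qed

section \<open>Diagonal and product sums in terms of divisor sums\<close>

lemma of_nat_divisor_sum: "of_nat (divisor_sum k n) = (\<Sum>d | d dvd n. of_nat d ^ k)"
  by (simp add: divisor_sum_def)

text \<open>Every natural number divides 0, so this sum over an infinite set defaults to 0. This
  removes the end terms of convolutions and the constant coefficient of
  \<open>sigma_fps\<close>.\<close>

lemma divisor_sum_0 [simp]: "divisor_sum k 0 = 0"
  by (simp add: divisor_sum_def)

text \<open>With \<open>a = b = d\<close> the equation reads \<open>d * (x + y) = n\<close>, which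
  has \<open>n div d - 1\<close> positive solutions for each divisor \<open>d\<close>; each
  contributes \<open>d ^ Suc k\<close>.\<close>

lemma sum_bilinear_reps_eq_first:
  fixes p :: "nat \<Rightarrow> nat \<Rightarrow> 'a :: field_char_0"
  assumes n: "n > 0" and p: "\<And>d. p d d = of_nat d ^ Suc k"
  shows "(\<Sum>(a, b, x, y) \<in> {(a, b, x, y) \<in> bilinear_reps n. a = b}. p a b) =
         of_nat n * of_nat (divisor_sum k n) - of_nat (divisor_sum (Suc k) n)"
proof -
  have fin: "finite {d. d dvd n}" using n by simp
  have "(\<Sum>(a, b, x, y) \<in> {(a, b, x, y) \<in> bilinear_reps n. a = b}. p a b) =
        (\<Sum>(d, x) \<in> (SIGMA d:{d. d dvd n}. {1..<n div d}). p d d)"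
  proof (rule sum.reindex_bij_witness[where i = "\<lambda>(d, x). (d, d, x, n div d - x)"
        and j = "\<lambda>(a, b, x, y). (a, x)"], goal_cases)
    case (1 z)
    then show ?case by (auto simp: bilinear_reps_def simp flip: distrib_left)
  next
    case (2 z)
    then show ?case by (auto simp: bilinear_reps_def simp flip: distrib_left)
  next
    case (3 z)
    then show ?case by auto
  next
    case (4 z)
    then show ?case using n
      by (auto simp: bilinear_reps_def dvd_pos_nat simp flip: distrib_left)
  next
    case (5 z)
    then show ?case by auto
  qed
  also have "\<dots> = (\<Sum>d | d dvd n. \<Sum>x\<in>{1..<n div d}. p d d)"
    by (subst sum.Sigma) (use fin in auto)
  also have "\<dots> = (\<Sum>d | d dvd n. of_nat n * of_nat d ^ k - of_nat d ^ Suc k)"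
  proof (rule sum.cong[OF refl])
    fix d assume "d \<in> {d. d dvd n}"
    then obtain m where m: "n = d * m" by auto
    then have "m > 0" "d > 0" using n by auto
    then show "(\<Sum>x\<in>{1..<n div d}. p d d) = of_nat n * of_nat d ^ k - of_nat d ^ Suc k"
      using m by (simp add: p of_nat_diff algebra_simps)
  qed
  also have "\<dots> = of_nat n * of_nat (divisor_sum k n) - of_nat (divisor_sum (Suc k) n)"
    by (simp add: of_nat_divisor_sum sum_subtractf sum_distrib_left)
  finally show ?thesis .
qed

text \<open>With \<open>x = y\<close> the equation reads \<open>(a + b) * x = n\<close>: for
  \<open>d = a + b\<close>, \<open>x\<close> is the cofactor of \<open>d\<close> and only
  \<open>b < d\<close> remains free.\<close>

lemma sum_bilinear_reps_eq_second:
  fixes p :: "nat \<Rightarrow> nat \<Rightarrow> 'a :: comm_monoid_add"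
  assumes n: "n > 0"
  shows "(\<Sum>(a, b, x, y) \<in> {(a, b, x, y) \<in> bilinear_reps n. x = y}. p (a + b) b) =
         (\<Sum>d | d dvd n. \<Sum>b\<in>{1..<d}. p d b)"
proof -
  have fin: "finite {d. d dvd n}" using n by simp
  have "(\<Sum>(a, b, x, y) \<in> {(a, b, x, y) \<in> bilinear_reps n. x = y}. p (a + b) b) =
        (\<Sum>(d, b) \<in> (SIGMA d:{d. d dvd n}. {1..<d}). p d b)"
  proof (rule sum.reindex_bij_witness[where i = "\<lambda>(d, b). (d - b, b, n div d, n div d)"
        and j = "\<lambda>(a, b, x, y). (a + b, b)"], goal_cases)
    case (1 z)
    then show ?case by (auto simp: bilinear_reps_def simp flip: distrib_right)
  next
    case (2 z)
    then show ?case by (auto simp: bilinear_reps_def simp flip: distrib_right)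
  next
    case (3 z)
    then show ?case by auto
  next
    case (4 z)
    then show ?case using n
      by (auto simp: bilinear_reps_def div_greater_zero_iff dvd_imp_le dvd_pos_nat
          simp flip: distrib_right)
  next
    case (5 z)
    then show ?case by auto
  qed
  also have "\<dots> = (\<Sum>d | d dvd n. \<Sum>b\<in>{1..<d}. p d b)"
    by (subst sum.Sigma) (use fin in auto)
  finally show ?thesis .
qed

text \<open>Put \<open>i = a * x\<close>; then \<open>x\<close> and \<open>y\<close> are the
  cofactors of a divisor \<open>a\<close> of \<open>i\<close> and a divisor \<open>b\<close> of
  \<open>n - i\<close>.\<close>

lemma sum_bilinear_reps_product:
  "(\<Sum>(a, b, x, y) \<in> bilinear_reps n. of_nat a ^ j * of_nat b ^ k) =
   (\<Sum>i=0..n. of_nat (divisor_sum j i) * of_nat (divisor_sum k (n - i)) :: 'a :: comm_semiring_1)"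
proof -
  let ?S = "SIGMA i:{1..<n}. {a. a dvd i} \<times> {b. b dvd n - i}"
  have "(\<Sum>i=0..n. of_nat (divisor_sum j i) * of_nat (divisor_sum k (n - i)) :: 'a) =
        (\<Sum>i\<in>{1..<n}. of_nat (divisor_sum j i) * of_nat (divisor_sum k (n - i)))"
    by (rule sum.mono_neutral_right) (auto simp: Suc_le_eq not_less order.order_iff_strict)
  also have "\<dots> =
      (\<Sum>i\<in>{1..<n}. \<Sum>(a, b)\<in>{a. a dvd i} \<times> {b. b dvd n - i}. of_nat a ^ j * of_nat b ^ k)"
    by (simp add: of_nat_divisor_sum sum_product sum.cartesian_product)
  also have "\<dots> = (\<Sum>(i, a, b)\<in>?S. of_nat a ^ j * of_nat b ^ k)"
    by (subst sum.Sigma) (auto simp: case_prod_unfold)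
  also have "\<dots> = (\<Sum>(a, b, x, y) \<in> bilinear_reps n. of_nat a ^ j * of_nat b ^ k)"
  proof (rule sum.reindex_bij_witness[where j = "\<lambda>(i, a, b). (a, b, i div a, (n - i) div b)"
        and i = "\<lambda>(a, b, x, y). (a * x, a, b)"], goal_cases)
    case (1 z)
    then show ?case by auto
  next
    case (2 z)
    then show ?case by (auto simp: bilinear_reps_def dvd_div_eq_0_iff dvd_pos_nat intro!: Nat.gr0I)
  next
    case (3 z)
    then show ?case by (auto simp: bilinear_reps_def)
  next
    case (4 z)
    then show ?case by (auto simp: bilinear_reps_def)
  next
    case (5 z)
    then show ?case by auto
  qed
  finally show ?thesis by simp
qed

section \<open>Two reflection-invariant forms\<close>

text \<open>Faulhaber's formulas with denominators cleared, so that each induction step is a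
  polynomial identity. The exponent 1 stays explicit to fit the uniform shape \<open>?S k\<close>
  used below.\<close>

lemma sum_powers_below:
  fixes m :: nat
  shows "2 * (\<Sum>b<m. of_nat b ^ 1) = (of_nat m * (of_nat m - 1) :: 'a :: field_char_0)"
    and "6 * (\<Sum>b<m. of_nat b ^ 2) = (of_nat m * (of_nat m - 1) * (2 * of_nat m - 1) :: 'a)"
    and "4 * (\<Sum>b<m. of_nat b ^ 3) = (of_nat m ^ 2 * (of_nat m - 1) ^ 2 :: 'a)"
    and "30 * (\<Sum>b<m. of_nat b ^ 4) =
        (of_nat m * (of_nat m - 1) * (2 * of_nat m - 1) * (3 * of_nat m ^ 2 - 3 * of_nat m
        - 1) :: 'a)"
    and "12 * (\<Sum>b<m. of_nat b ^ 5) =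
        (of_nat m ^ 2 * (of_nat m - 1) ^ 2 * (2 * of_nat m ^ 2 - 2 * of_nat m - 1) :: 'a)"
    and "42 * (\<Sum>b<m. of_nat b ^ 6) =
        (of_nat m * (of_nat m - 1) * (2 * of_nat m - 1) * (3 * of_nat m ^ 4 - 6 * of_nat m ^ 3
        + 3 * of_nat m + 1) :: 'a)"
proof (induction m)
  case (Suc m)
  {
    case 1
    show ?case unfolding sum.lessThan_Suc of_nat_Suc distrib_left Suc.IH(1) by algebra
  next
    case 2
    show ?case unfolding sum.lessThan_Suc of_nat_Suc distrib_left Suc.IH(2) by algebra
  next
    case 3
    show ?case unfolding sum.lessThan_Suc of_nat_Suc distrib_left Suc.IH(3) by algebra
  next
    case 4
    show ?case unfolding sum.lessThan_Suc of_nat_Suc distrib_left Suc.IH(4) by algebra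
  next
    case 5
    show ?case unfolding sum.lessThan_Suc of_nat_Suc distrib_left Suc.IH(5) by algebra
  next
    case 6
    show ?case unfolding sum.lessThan_Suc of_nat_Suc distrib_left Suc.IH(6) by algebra
  }
qed simp_all

lemma sum_atLeast1_lessThan:
  fixes f :: "nat \<Rightarrow> 'a :: ab_group_add"
  assumes "m > 0"
  shows "sum f {1..<m} = sum f {..<m} - f 0"
proof -
  have "{..<m} = insert 0 {1..<m}" using assms by auto
  thus ?thesis by simp
qed

text \<open>
  The forms \<open>eform\<close> and \<open>dform\<close> are invariant under the reflections \<open>(a, b) \<mapsto> (b, a)\<close> and
  \<open>(a, b) \<mapsto> (a, a - b)\<close>, as \<open>sum_bilinear_reps_invariant\<close> requires. In
  \<open>p (a, b) - p (a + b, b)\<close> the terms that are even in \<open>a\<close> and \<open>b\<close> cancel, and the remaining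
  ones are products of odd powers, hence yield convolutions of odd-index divisor sums.
\<close>

definition eform :: "nat \<Rightarrow> nat \<Rightarrow> 'a :: comm_ring_1" where
  "eform a b = of_nat a ^ 2 - of_nat a * of_nat b + of_nat b ^ 2"

lemma eform_commute: "eform a b = eform b a"
  by (simp add: eform_def algebra_simps)

lemma eform_reflect: "eform (a + b) b = eform (a + b) a"
  by (simp add: eform_def algebra_simps power2_eq_square)

lemma eform_diag: "eform a a = of_nat a ^ 2"
  by (simp add: eform_def power2_eq_square)

lemma sum_eform:
  assumes "d > 0"
  shows "6 * (\<Sum>b\<in>{1..<d}. eform d b) =
      (5 * of_nat d ^ 3 - 6 * of_nat d ^ 2 + of_nat d :: 'a :: field_char_0)"
proof -
  let ?S = "\<lambda>k. \<Sum>b<d. of_nat b ^ k :: 'a" and ?d = "of_nat d :: 'a"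
  have "eform d b =
      (?d ^ 2 - ?d * of_nat b + of_nat b ^ 2 :: 'a)" for b
    by (rule eform_def)
  hence "(\<Sum>b<d. eform d b :: 'a) =
      ?d ^ 2 * ?d - ?d * ?S 1 + ?S 2"
    by (simp add: sum.distrib sum_subtractf sum_distrib_left)
  \<comment> \<open>The range of \<open>b\<close> starts at 1, so the term
    \<open>eform d 0 = d ^ 2\<close> is taken off the full sum.\<close>
  hence "6 * (\<Sum>b\<in>{1..<d}. eform d b :: 'a) =
      6 * (?d ^ 2 * ?d - ?d * ?S 1 + ?S 2 - ?d ^ 2)"
    unfolding sum_atLeast1_lessThan[OF assms] by (simp add: eform_def)
  \<comment> \<open>The power sums are grouped with the multipliers under which
    \<open>sum_powers_below\<close> rewrites them.\<close>
  also have "\<dots> =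
      6 * ?d ^ 3 - 3 * ?d * (2 * ?S 1) + 6 * ?S 2 - 6 * ?d ^ 2"
    by algebra
  also have "\<dots> = 5 * ?d ^ 3 - 6 * ?d ^ 2 + ?d"
    unfolding sum_powers_below by algebra
  finally show ?thesis .
qed

lemma sum_eform_power2:
  assumes "d > 0"
  shows "30 * (\<Sum>b\<in>{1..<d}. eform d b ^ 2) =
      (21 * of_nat d ^ 5 - 30 * of_nat d ^ 4 + 10 * of_nat d ^ 3
      - of_nat d :: 'a :: field_char_0)"
proof -
  let ?S = "\<lambda>k. \<Sum>b<d. of_nat b ^ k :: 'a" and ?d = "of_nat d :: 'a"
  have "eform d b ^ 2 =
      (?d ^ 4 - 2 * ?d ^ 3 * of_nat b + 3 * ?d ^ 2 * of_nat b ^ 2 - 2 * ?d * of_nat b ^ 3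
          + of_nat b ^ 4 :: 'a)" for b
    unfolding eform_def by algebra
  hence "(\<Sum>b<d. eform d b ^ 2 :: 'a) =
      ?d ^ 4 * ?d - 2 * ?d ^ 3 * ?S 1 + 3 * ?d ^ 2 * ?S 2 - 2 * ?d * ?S 3 + ?S 4"
    by (simp add: sum.distrib sum_subtractf sum_distrib_left)
  hence "30 * (\<Sum>b\<in>{1..<d}. eform d b ^ 2 :: 'a) =
      30 * (?d ^ 4 * ?d - 2 * ?d ^ 3 * ?S 1 + 3 * ?d ^ 2 * ?S 2 - 2 * ?d * ?S 3 + ?S 4 - ?d ^ 4)"
    unfolding sum_atLeast1_lessThan[OF assms] by (simp add: eform_def)
  also have "\<dots> =
      30 * ?d ^ 5 - 30 * ?d ^ 3 * (2 * ?S 1) + 15 * ?d ^ 2 * (6 * ?S 2) - 15 * ?d * (4 * ?S 3)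
          + 30 * ?S 4 - 30 * ?d ^ 4"
    by algebra
  also have "\<dots> = 21 * ?d ^ 5 - 30 * ?d ^ 4 + 10 * ?d ^ 3 - ?d"
    unfolding sum_powers_below by algebra
  finally show ?thesis .
qed

text \<open>The multiplier 420 is the least common multiple of the Faulhaber denominators 2, 6, 4,
  30, 12 and 42.\<close>

lemma sum_eform_power3:
  assumes "d > 0"
  shows "420 * (\<Sum>b\<in>{1..<d}. eform d b ^ 3) =
      (249 * of_nat d ^ 7 - 420 * of_nat d ^ 6 + 210 * of_nat d ^ 5 - 49 * of_nat d ^ 3
      + 10 * of_nat d :: 'a :: field_char_0)"
proof -
  let ?S = "\<lambda>k. \<Sum>b<d. of_nat b ^ k :: 'a" and ?d = "of_nat d :: 'a"
  have "eform d b ^ 3 =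
      (?d ^ 6 - 3 * ?d ^ 5 * of_nat b + 6 * ?d ^ 4 * of_nat b ^ 2 - 7 * ?d ^ 3 * of_nat b ^ 3
          + 6 * ?d ^ 2 * of_nat b ^ 4 - 3 * ?d * of_nat b ^ 5 + of_nat b ^ 6 :: 'a)" for b
    unfolding eform_def by algebra
  hence "(\<Sum>b<d. eform d b ^ 3 :: 'a) =
      ?d ^ 6 * ?d - 3 * ?d ^ 5 * ?S 1 + 6 * ?d ^ 4 * ?S 2 - 7 * ?d ^ 3 * ?S 3 + 6 * ?d ^ 2 * ?S 4
          - 3 * ?d * ?S 5 + ?S 6"
    by (simp add: sum.distrib sum_subtractf sum_distrib_left)
  hence "420 * (\<Sum>b\<in>{1..<d}. eform d b ^ 3 :: 'a) =
      420 * (?d ^ 6 * ?d - 3 * ?d ^ 5 * ?S 1 + 6 * ?d ^ 4 * ?S 2 - 7 * ?d ^ 3 * ?S 3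
          + 6 * ?d ^ 2 * ?S 4 - 3 * ?d * ?S 5 + ?S 6 - ?d ^ 6)"
    unfolding sum_atLeast1_lessThan[OF assms] by (simp add: eform_def)
  also have "\<dots> =
      420 * ?d ^ 7 - 630 * ?d ^ 5 * (2 * ?S 1) + 420 * ?d ^ 4 * (6 * ?S 2)
          - 735 * ?d ^ 3 * (4 * ?S 3) + 84 * ?d ^ 2 * (30 * ?S 4) - 105 * ?d * (12 * ?S 5)
          + 10 * (42 * ?S 6) - 420 * ?d ^ 6"
    by algebra
  also have "\<dots> = 249 * ?d ^ 7 - 420 * ?d ^ 6 + 210 * ?d ^ 5 - 49 * ?d ^ 3 + 10 * ?d"
    unfolding sum_powers_below by algebra
  finally show ?thesis .
qed

definition dform :: "nat \<Rightarrow> nat \<Rightarrow> 'a :: comm_ring_1" where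
  "dform a b = (of_nat a * of_nat b * (of_nat a - of_nat b)) ^ 2"

lemma sum_dform:
  assumes "d > 0"
  shows "30 * (\<Sum>b\<in>{1..<d}. dform d b) = (of_nat d ^ 7 - of_nat d ^ 3 :: 'a :: field_char_0)"
proof -
  let ?S = "\<lambda>k. \<Sum>b<d. of_nat b ^ k :: 'a" and ?d = "of_nat d :: 'a"
  have "dform d b =
      (?d ^ 4 * of_nat b ^ 2 - 2 * ?d ^ 3 * of_nat b ^ 3 + ?d ^ 2 * of_nat b ^ 4 :: 'a)" for b
    unfolding dform_def by algebra
  hence "(\<Sum>b<d. dform d b :: 'a) =
      ?d ^ 4 * ?S 2 - 2 * ?d ^ 3 * ?S 3 + ?d ^ 2 * ?S 4"
    by (simp add: sum.distrib sum_subtractf sum_distrib_left)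
  hence "30 * (\<Sum>b\<in>{1..<d}. dform d b :: 'a) =
      30 * (?d ^ 4 * ?S 2 - 2 * ?d ^ 3 * ?S 3 + ?d ^ 2 * ?S 4)"
    unfolding sum_atLeast1_lessThan[OF assms] by (simp add: dform_def)
  also have "\<dots> =
      5 * ?d ^ 4 * (6 * ?S 2) - 15 * ?d ^ 3 * (4 * ?S 3) + ?d ^ 2 * (30 * ?S 4)"
    by algebra
  also have "\<dots> = ?d ^ 7 - ?d ^ 3"
    unfolding sum_powers_below by algebra
  finally show ?thesis .
qed

section \<open>Convolution identities for divisor sums\<close>

definition sigma_fps :: "nat \<Rightarrow> 'a :: semiring_1 fps" where
  "sigma_fps k = Abs_fps (\<lambda>n. of_nat (divisor_sum k n))"

lemma sigma_fps_nth [simp]: "fps_nth (sigma_fps k) n = of_nat (divisor_sum k n)"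
  by (simp add: sigma_fps_def)

lemma sigma_fps_mult_nth:
  "fps_nth (sigma_fps j * sigma_fps k) n =
     (\<Sum>(a, b, x, y) \<in> bilinear_reps n. of_nat a ^ j * of_nat b ^ k :: 'a :: comm_ring_1)"
  by (simp add: fps_mult_nth sum_bilinear_reps_product)

text \<open>Through this rule the factor \<open>n\<close> from the diagonal \<open>a = b\<close>
  becomes a derivative.\<close>

lemma fps_XD_nth [simp]: "fps_nth (fps_XD f) n = of_nat n * fps_nth f n"
  by (simp add: fps_XD_def fps_mult_fps_X_deriv_shift)

lemma fps_nth_numeral_mult [simp]:
  "fps_nth (numeral c * f) n = numeral c * fps_nth (f :: 'a :: comm_ring_1 fps) n"
  by (simp add: numeral_fps_const)

lemma sum_bilinear_reps_diff:
  fixes p :: "nat \<Rightarrow> nat \<Rightarrow> 'a :: field_char_0"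
  assumes "n > 0" "\<And>a b. p a b = p b a" "\<And>a b. p (a + b) b = p (a + b) a"
    and "\<And>d. p d d = of_nat d ^ Suc k"
  shows "(\<Sum>(a, b, x, y) \<in> bilinear_reps n. p a b - p (a + b) b) =
         of_nat n * of_nat (divisor_sum k n) - of_nat (divisor_sum (Suc k) n)
         - (\<Sum>d | d dvd n. \<Sum>b\<in>{1..<d}. p d b)"
  using sum_bilinear_reps_invariant[of p n, OF assms(2,3)]
    sum_bilinear_reps_eq_first[of n p k, OF assms(1,4)]
    sum_bilinear_reps_eq_second[of n p, OF assms(1)]
  by (simp add: case_prod_unfold sum_subtractf)

lemma sum_bilinear_reps_eform:
  assumes "n > 0" "k > 0"
  shows "(\<Sum>(a, b, x, y) \<in> bilinear_reps n. eform a b ^ k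
      - eform (a + b) b ^ k :: 'a :: field_char_0) =
         of_nat n * of_nat (divisor_sum (2 * k - 1) n) - of_nat (divisor_sum (2 * k) n)
         - (\<Sum>d | d dvd n. \<Sum>b\<in>{1..<d}. eform d b ^ k)"
proof -
  \<comment> \<open>The diagonal value \<open>d ^ (2 * k)\<close> must have the shape
    \<open>d ^ Suc _\<close>; \<open>k > 0\<close> makes the truncated subtraction harmless.\<close>
  have Suc: "Suc (2 * k - 1) = 2 * k" using assms by simp
  have "(\<Sum>(a, b, x, y) \<in> bilinear_reps n. eform a b ^ k - eform (a + b) b ^ k :: 'a) =
      of_nat n * of_nat (divisor_sum (2 * k - 1) n) - of_nat (divisor_sum (Suc (2 * k - 1)) n)
      - (\<Sum>d | d dvd n. \<Sum>b\<in>{1..<d}. eform d b ^ k)"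
  proof (rule sum_bilinear_reps_diff)
    show "eform a b ^ k = (eform b a ^ k :: 'a)" for a b
      by (simp only: eform_commute[of a b])
    show "eform (a + b) b ^ k = (eform (a + b) a ^ k :: 'a)" for a b
      by (simp only: eform_reflect)
    show "eform d d ^ k = (of_nat d ^ Suc (2 * k - 1) :: 'a)" for d
      by (simp only: Suc eform_diag power_mult)
  qed (rule assms)
  thus ?thesis by (simp only: Suc)
qed

text \<open>The factor \<open>a - b\<close> kills the diagonal \<open>a = b\<close>, so no term
  weighted by \<open>n\<close> appears, and hence no derivative in
  \<open>sigma_fps_3_3\<close>.\<close>

lemma sum_bilinear_reps_dform:
  assumes "n > 0"
  shows "(\<Sum>(a, b, x, y) \<in> bilinear_reps n. dform a b - dform (a + b) b :: 'a :: field_char_0) =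
         - (\<Sum>d | d dvd n. \<Sum>b\<in>{1..<d}. dform d b)"
proof -
  have "dform a b = (dform b a :: 'a)" "dform (a + b) b = (dform (a + b) a :: 'a)" for a b
    unfolding dform_def of_nat_add by algebra+
  moreover have "(\<Sum>(a, b, x, y) \<in> {(a, b, x, y) \<in> bilinear_reps n. a = b}. dform a b) = 0"
    by (rule sum.neutral) (auto simp: dform_def)
  ultimately show ?thesis
    using sum_bilinear_reps_invariant[of "dform :: nat \<Rightarrow> nat \<Rightarrow> 'a" n]
      sum_bilinear_reps_eq_second[of n "dform :: nat \<Rightarrow> nat \<Rightarrow> 'a"]
      assms
    by (simp add: case_prod_unfold sum_subtractf)
qed

text \<open>Comes from \<open>eform\<close> itself. The even-index sums
  \<open>divisor_sum 2 n\<close> from the two diagonals cancel.\<close>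

lemma sigma_fps_1_1:
  "12 * (sigma_fps 1 * sigma_fps 1) =
     (5 * sigma_fps 3 + sigma_fps 1 - 6 * fps_XD (sigma_fps 1) :: 'a :: field_char_0 fps)"
proof (rule fps_ext)
  fix n
  let ?s = "\<lambda>k. of_nat (divisor_sum k n) :: 'a"
  let ?c = "\<lambda>j k. fps_nth (sigma_fps j * sigma_fps k) n :: 'a"
  let ?X = "(\<Sum>d | d dvd n. \<Sum>b\<in>{1..<d}. eform d b :: 'a)"
  show "fps_nth (12 * (sigma_fps 1 * sigma_fps 1)) n =
      fps_nth (5 * sigma_fps 3 + sigma_fps 1 - 6 * fps_XD (sigma_fps 1) :: 'a fps) n"
  proof (cases "n = 0")
    case False
    hence n: "n > 0" by simp
    have "6 * ?X = (\<Sum>d | d dvd n. 5 * of_nat d ^ 3 - 6 * of_nat d ^ 2 + of_nat d)"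
      unfolding sum_distrib_left[of 6 _ "{d. d dvd n}"]
      using n by (intro sum.cong refl sum_eform) (auto intro: dvd_pos_nat)
    also have "\<dots> = 5 * ?s 3 - 6 * ?s 2 + ?s 1"
      by (simp add: of_nat_divisor_sum sum.distrib sum_subtractf sum_distrib_left)
    finally have X: "6 * ?X = \<dots>" .
    \<comment> \<open>Trivial exponents are written out so that \<open>sigma_fps_mult_nth\<close>
      recognises the summand.\<close>
    have "eform a b - eform (a + b) b =
        (- 2 * (of_nat a ^ 1 * of_nat b ^ 1) :: 'a)" for a b
      unfolding eform_def of_nat_add by algebra
    hence "- 2 * ?c 1 1 = (\<Sum>(a, b, x, y) \<in> bilinear_reps n. eform a b - eform (a + b) b :: 'a)"
      by (simp only: sigma_fps_mult_nth sum_distrib_left sum.distrib sum_subtractf case_prod_unfold)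
    also have "\<dots> = of_nat n * ?s 1 - ?s 2 - ?X"
      using sum_bilinear_reps_eform[OF n, of 1] by simp
    finally have E: "- 2 * ?c 1 1 = \<dots>" .
    show ?thesis
      unfolding fps_add_nth fps_sub_nth fps_nth_numeral_mult fps_XD_nth sigma_fps_nth
      using X E by algebra
  qed (simp add: bilinear_reps_0)
qed

text \<open>Comes from the square of \<open>eform\<close>; the two mixed convolutions agree by
  commutativity, and \<open>divisor_sum 4 n\<close> cancels.\<close>

lemma sigma_fps_1_3:
  "240 * (sigma_fps 1 * sigma_fps 3) =
     (21 * sigma_fps 5 + 10 * sigma_fps 3 - sigma_fps 1
         - 30 * fps_XD (sigma_fps 3) :: 'a :: field_char_0 fps)"
proof (rule fps_ext)
  fix n
  let ?s = "\<lambda>k. of_nat (divisor_sum k n) :: 'a"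
  let ?c = "\<lambda>j k. fps_nth (sigma_fps j * sigma_fps k) n :: 'a"
  let ?X = "(\<Sum>d | d dvd n. \<Sum>b\<in>{1..<d}. eform d b ^ 2 :: 'a)"
  show "fps_nth (240 * (sigma_fps 1 * sigma_fps 3)) n =
      fps_nth (21 * sigma_fps 5 + 10 * sigma_fps 3 - sigma_fps 1
          - 30 * fps_XD (sigma_fps 3) :: 'a fps) n"
  proof (cases "n = 0")
    case False
    hence n: "n > 0" by simp
    have "30 * ?X = (\<Sum>d | d dvd n. 21 * of_nat d ^ 5 - 30 * of_nat d ^ 4 + 10 * of_nat d ^ 3
        - of_nat d)"
      unfolding sum_distrib_left[of 30 _ "{d. d dvd n}"]
      using n by (intro sum.cong refl sum_eform_power2) (auto intro: dvd_pos_nat)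
    also have "\<dots> = 21 * ?s 5 - 30 * ?s 4 + 10 * ?s 3 - ?s 1"
      by (simp add: of_nat_divisor_sum sum.distrib sum_subtractf sum_distrib_left)
    finally have X: "30 * ?X = \<dots>" .
    have "eform a b ^ 2 - eform (a + b) b ^ 2 =
        (- 4 * (of_nat a ^ 1 * of_nat b ^ 3) - 4 * (of_nat a ^ 3 * of_nat b ^ 1) :: 'a)" for a b
      unfolding eform_def of_nat_add by algebra
    hence "- 4 * ?c 1 3 - 4 * ?c 3 1 =
        (\<Sum>(a, b, x, y) \<in> bilinear_reps n. eform a b ^ 2 - eform (a + b) b ^ 2 :: 'a)"
      by (simp only: sigma_fps_mult_nth sum_distrib_left sum.distrib sum_subtractf case_prod_unfold)
    also have "\<dots> = of_nat n * ?s 3 - ?s 4 - ?X"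
      using sum_bilinear_reps_eform[OF n, of 2] by simp
    finally have E: "- 4 * ?c 1 3 - 4 * ?c 3 1 = \<dots>" .
    have comm: "?c 3 1 = ?c 1 3"
      by (simp only: mult.commute)
    show ?thesis
      unfolding fps_add_nth fps_sub_nth fps_nth_numeral_mult fps_XD_nth sigma_fps_nth
      using X E comm by algebra
  qed (simp add: bilinear_reps_0)
qed

text \<open>Comes from \<open>dform\<close>. In terms of Eisenstein series this is the identity
  \<open>E4 ^ 2 = E8\<close>.\<close>

lemma sigma_fps_3_3:
  "120 * (sigma_fps 3 * sigma_fps 3) =
     (sigma_fps 7 - sigma_fps 3 :: 'a :: field_char_0 fps)"
proof (rule fps_ext)
  fix n
  let ?s = "\<lambda>k. of_nat (divisor_sum k n) :: 'a"
  let ?c = "\<lambda>j k. fps_nth (sigma_fps j * sigma_fps k) n :: 'a"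
  let ?X = "(\<Sum>d | d dvd n. \<Sum>b\<in>{1..<d}. dform d b :: 'a)"
  show "fps_nth (120 * (sigma_fps 3 * sigma_fps 3)) n =
      fps_nth (sigma_fps 7 - sigma_fps 3 :: 'a fps) n"
  proof (cases "n = 0")
    case False
    hence n: "n > 0" by simp
    have "30 * ?X = (\<Sum>d | d dvd n. of_nat d ^ 7 - of_nat d ^ 3)"
      unfolding sum_distrib_left[of 30 _ "{d. d dvd n}"]
      using n by (intro sum.cong refl sum_dform) (auto intro: dvd_pos_nat)
    also have "\<dots> = ?s 7 - ?s 3"
      by (simp add: of_nat_divisor_sum sum.distrib sum_subtractf sum_distrib_left)
    finally have X: "30 * ?X = \<dots>" .
    have "dform a b - dform (a + b) b =
        (- 4 * (of_nat a ^ 3 * of_nat b ^ 3) :: 'a)" for a b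
      unfolding dform_def of_nat_add by algebra
    hence "- 4 * ?c 3 3 = (\<Sum>(a, b, x, y) \<in> bilinear_reps n. dform a b - dform (a + b) b :: 'a)"
      by (simp only: sigma_fps_mult_nth sum_distrib_left sum.distrib sum_subtractf case_prod_unfold)
    also have "\<dots> = - ?X"
      using sum_bilinear_reps_dform[OF n] by simp
    finally have E: "- 4 * ?c 3 3 = \<dots>" .
    show ?thesis
      unfolding fps_add_nth fps_sub_nth fps_nth_numeral_mult fps_XD_nth sigma_fps_nth
      using X E by algebra
  qed (simp add: bilinear_reps_0)
qed

text \<open>Comes from the cube of \<open>eform\<close>, whose difference also contains
  \<open>a ^ 3 * b ^ 3\<close>; that convolution is eliminated by
  \<open>sigma_fps_3_3\<close>.\<close>

lemma sigma_fps_1_5: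
  "504 * (sigma_fps 1 * sigma_fps 5) =
     (20 * sigma_fps 7 + 21 * sigma_fps 5 + sigma_fps 1
         - 42 * fps_XD (sigma_fps 5) :: 'a :: field_char_0 fps)"
proof (rule fps_ext)
  fix n
  let ?s = "\<lambda>k. of_nat (divisor_sum k n) :: 'a"
  let ?c = "\<lambda>j k. fps_nth (sigma_fps j * sigma_fps k) n :: 'a"
  let ?X = "(\<Sum>d | d dvd n. \<Sum>b\<in>{1..<d}. eform d b ^ 3 :: 'a)"
  show "fps_nth (504 * (sigma_fps 1 * sigma_fps 5)) n =
      fps_nth (20 * sigma_fps 7 + 21 * sigma_fps 5 + sigma_fps 1
          - 42 * fps_XD (sigma_fps 5) :: 'a fps) n"
  proof (cases "n = 0")
    case False
    hence n: "n > 0" by simp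
    have "420 * ?X = (\<Sum>d | d dvd n. 249 * of_nat d ^ 7 - 420 * of_nat d ^ 6 + 210 * of_nat d ^ 5
        - 49 * of_nat d ^ 3 + 10 * of_nat d)"
      unfolding sum_distrib_left[of 420 _ "{d. d dvd n}"]
      using n by (intro sum.cong refl sum_eform_power3) (auto intro: dvd_pos_nat)
    also have "\<dots> = 249 * ?s 7 - 420 * ?s 6 + 210 * ?s 5 - 49 * ?s 3 + 10 * ?s 1"
      by (simp add: of_nat_divisor_sum sum.distrib sum_subtractf sum_distrib_left)
    finally have X: "420 * ?X = \<dots>" .
    have "eform a b ^ 3 - eform (a + b) b ^ 3 =
        (- 6 * (of_nat a ^ 1 * of_nat b ^ 5) - 6 * (of_nat a ^ 5 * of_nat b ^ 1)
            - 14 * (of_nat a ^ 3 * of_nat b ^ 3) :: 'a)" for a b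
      unfolding eform_def of_nat_add by algebra
    hence "- 6 * ?c 1 5 - 6 * ?c 5 1 - 14 * ?c 3 3 =
        (\<Sum>(a, b, x, y) \<in> bilinear_reps n. eform a b ^ 3 - eform (a + b) b ^ 3 :: 'a)"
      by (simp only: sigma_fps_mult_nth sum_distrib_left sum.distrib sum_subtractf case_prod_unfold)
    also have "\<dots> = of_nat n * ?s 5 - ?s 6 - ?X"
      using sum_bilinear_reps_eform[OF n, of 3] by simp
    finally have E: "- 6 * ?c 1 5 - 6 * ?c 5 1 - 14 * ?c 3 3 = \<dots>" .
    have comm: "?c 5 1 = ?c 1 5"
      by (simp only: mult.commute)
    have sq: "120 * ?c 3 3 = ?s 7 - ?s 3"
      by (simp only: sigma_fps_3_3 fps_sub_nth sigma_fps_nth flip: fps_nth_numeral_mult)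
    show ?thesis
      unfolding fps_add_nth fps_sub_nth fps_nth_numeral_mult fps_XD_nth sigma_fps_nth
      using X E comm sq by algebra
  qed (simp add: bilinear_reps_0)
qed

section \<open>Ramanujan's differential equations\<close>

lemma fps_XD_mult: "fps_XD (f * g) = fps_XD f * g + f * fps_XD (g :: 'a :: comm_ring_1 fps)"
  by (simp add: fps_XD_def algebra_simps)

lemma fps_XD_diff: "fps_XD (f - g) = fps_XD f - fps_XD (g :: 'a :: comm_ring_1 fps)"
  by (simp add: fps_XD_def algebra_simps)

lemma fps_XD_numeral: "fps_XD (numeral c :: 'a :: comm_ring_1 fps) = 0"
  by (simp add: fps_XD_def)

lemma fps_XD_1: "fps_XD (1 :: 'a :: comm_ring_1 fps) = 0"
  by (simp add: fps_XD_def)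

definition E2_fps :: "'a :: comm_ring_1 fps" where "E2_fps = 1 - 24 * sigma_fps 1"
definition E4_fps :: "'a :: comm_ring_1 fps" where "E4_fps = 1 + 240 * sigma_fps 3"
definition E6_fps :: "'a :: comm_ring_1 fps" where "E6_fps = 1 - 504 * sigma_fps 5"

lemmas Eisenstein_fps_defs = E2_fps_def E4_fps_def E6_fps_def

lemmas fps_XD_rules = fps_XD_mult fps_XD_diff fps_XD_add fps_XD_numeral fps_XD_1
  mult_zero_left add_0_left

text \<open>After expansion this is 48 times \<open>sigma_fps_1_1\<close>, up to linear terms that
  cancel.\<close>

lemma Ramanujan_E2: "12 * fps_XD E2_fps = E2_fps ^ 2 - (E4_fps :: 'a :: field_char_0 fps)"
  unfolding Eisenstein_fps_defs fps_XD_rules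
  using sigma_fps_1_1[where 'a = 'a] by algebra

lemma Ramanujan_E4: "3 * fps_XD E4_fps = E2_fps * E4_fps - (E6_fps :: 'a :: field_char_0 fps)"
  unfolding Eisenstein_fps_defs fps_XD_rules
  using sigma_fps_1_3[where 'a = 'a] by algebra

text \<open>Both \<open>E2_fps * E6_fps\<close> and \<open>E4_fps ^ 2\<close> produce
  \<open>480 * sigma_fps 7\<close>, which cancels in the difference.\<close>

lemma Ramanujan_E6: "2 * fps_XD E6_fps = E2_fps * E6_fps - (E4_fps ^ 2 :: 'a :: field_char_0 fps)"
  unfolding Eisenstein_fps_defs fps_XD_rules
  using sigma_fps_1_5[where 'a = 'a] sigma_fps_3_3[where 'a = 'a] by algebra

lemma E4_third_order_ode:
  "2 * fps_XD (fps_XD (fps_XD E4_fps)) + 5 * fps_XD E2_fps * fps_XD E4_fps =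
     2 * E2_fps * fps_XD (fps_XD (E4_fps :: 'a :: field_char_0 fps))"
proof -
  define P Q R :: "'a fps" where "P = E2_fps" and "Q = E4_fps" and "R = E6_fps"
  define p p2 q q2 q3 r r2 where
    "p = fps_XD P" and "p2 = fps_XD p" and "q = fps_XD Q" and "q2 = fps_XD q" and "q3 = fps_XD q2"
    and "r = fps_XD R" and "r2 = fps_XD r"
  note defs = p_def q_def r_def p2_def q2_def r2_def q3_def
  have 1: "12 * p = P * P - Q" "3 * q = P * Q - R" "2 * r = P * R - Q * Q"
    using Ramanujan_E2[where 'a = 'a] Ramanujan_E4[where 'a = 'a] Ramanujan_E6[where 'a = 'a]
    by (simp_all add: P_def Q_def R_def p_def q_def r_def power2_eq_square)
  \<comment> \<open>With each derivative named as an indeterminate, the claim becomes a polynomial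
    consequence of the differentiated relations.\<close>
  have 2: "12 * p2 = p * P + P * p - q" "3 * q2 = p * Q + P * q - r"
    "2 * r2 = p * R + P * r - (q * Q + Q * q)"
    using 1[THEN arg_cong[of _ _ fps_XD]]
    by (simp_all only: fps_XD_rules flip: defs)
  have 3: "3 * q3 = p2 * Q + p * q + (p * q + P * q2) - r2"
    using 2(2)[THEN arg_cong[of _ _ fps_XD]]
    by (simp only: fps_XD_rules flip: defs)
  \<comment> \<open>The relations carry the factors 12, 3 and 2, so a multiple is derived first; 72
    is then cancelled in the domain of power series.\<close>
  have "72 * (2 * q3 + 5 * p * q) = 72 * (2 * P * q2)"
    using 1 2 3 by algebra
  hence "2 * q3 + 5 * p * q = 2 * P * q2"
    unfolding mult_cancel_left by simp
  thus ?thesis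
    by (simp only: defs P_def Q_def)
qed

section \<open>The Eisenstein series as functions on the upper half-plane\<close>

text \<open>There are at most \<open>n\<close> divisors, each with power at most
  \<open>n ^ k\<close>; polynomial growth suffices for convergence in the unit disc.\<close>

lemma divisor_sum_le: "divisor_sum k n \<le> n ^ Suc k"
proof (cases "n = 0")
  case False
  have "divisor_sum k n \<le> (\<Sum>d\<in>{1..n}. d ^ k)"
    unfolding divisor_sum_def using False
    by (intro sum_mono2) (auto dest: dvd_imp_le intro: Suc_leI dvd_pos_nat)
  also have "\<dots> \<le> (\<Sum>d\<in>{1..n}. n ^ k)"
    by (intro sum_mono power_mono) auto
  finally show ?thesis by simp
qed auto

lemma fps_conv_radius_fps_XD:
  fixes f :: "'a :: {banach, real_normed_field} fps"
  shows "fps_conv_radius f \<le> fps_conv_radius (fps_XD f)"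
  unfolding fps_XD_def o_def
  by (rule order_trans[OF _ fps_conv_radius_mult]) (simp add: fps_conv_radius_deriv)

text \<open>Start from the geometric series; each \<open>fps_XD\<close> multiplies the coefficients
  by \<open>n\<close> without shrinking the radius.\<close>

lemma conv_radius_of_nat_power:
  "conv_radius (\<lambda>n. of_nat n ^ k :: 'a :: {banach, real_normed_field}) \<ge> 1"
proof (induction k)
  case 0
  show ?case
    by (rule conv_radius_geI_ex') (auto intro!: summable_geometric)
next
  case (Suc k)
  with fps_conv_radius_fps_XD[of "Abs_fps (\<lambda>n. of_nat n ^ k :: 'a)"] show ?case
    by (simp add: fps_conv_radius_def)
qed

lemma fps_conv_radius_sigma: "fps_conv_radius (sigma_fps k :: complex fps) \<ge> 1"
  unfolding fps_conv_radius_def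
proof (rule conv_radius_geI_ex')
  fix r :: real assume r: "0 < r" "ereal r < 1"
  have "summable (\<lambda>n. of_nat n ^ Suc k * of_real r ^ n :: real)"
    using r by (intro summable_in_conv_radius less_le_trans[OF _ conv_radius_of_nat_power]) auto
  moreover have "norm (fps_nth (sigma_fps k) n * of_real r ^ n :: complex)
      \<le> of_nat n ^ Suc k * of_real r ^ n" for n
    using divisor_sum_le[of k n] r
    by (auto simp: norm_mult norm_power intro!: mult_right_mono simp flip: of_nat_power of_nat_mult)
  ultimately show "summable (\<lambda>n. fps_nth (sigma_fps k) n * of_real r ^ n :: complex)"
    by (rule summable_comparison_test'[where N = 0])
qed

lemma fps_conv_radius_E2_E4:
  "fps_conv_radius (E2_fps :: complex fps) \<ge> 1"
  "fps_conv_radius (E4_fps :: complex fps) \<ge> 1"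
  unfolding E2_fps_def E4_fps_def numeral_fps_const
  by (intro order_trans[OF _ fps_conv_radius_diff] order_trans[OF _ fps_conv_radius_add];
      simp add: fps_conv_radius_cmult_left fps_conv_radius_sigma)+

section \<open>Pulling power series back along the nome\<close>

lemma norm_nome_less_1: "z \<in> upper_half_plane \<Longrightarrow> norm (nome z) < 1"
  by (simp add: upper_half_plane_def nome_def)

lemma in_conv_radius_nome:
  assumes "z \<in> upper_half_plane" "fps_conv_radius f \<ge> 1"
  shows "ereal (norm (nome z)) < fps_conv_radius f"
  using less_le_trans[of "ereal (norm (nome z))" 1] norm_nome_less_1[OF assms(1)] assms(2) by auto

text \<open>The constant coefficient is 0, so splitting off the head gives the shifted sums in
  \<open>E2\<close> and \<open>E4\<close>.\<close>

lemma eval_sigma_fps_nome: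
  assumes "z \<in> upper_half_plane"
  shows "eval_fps (sigma_fps k) (nome z) = (\<Sum>n. of_nat (divisor_sum k (Suc n)) * nome z ^ Suc n)"
  unfolding eval_fps_def
  by (subst suminf_split_head)
     (use summable_fps[OF in_conv_radius_nome[OF assms fps_conv_radius_sigma]] in simp_all)

lemma fps_conv_radius_numeral_mult_sigma:
  "fps_conv_radius (numeral c * sigma_fps k :: complex fps) \<ge> 1"
  by (simp add: numeral_fps_const fps_conv_radius_cmult_left fps_conv_radius_sigma)

lemma
  assumes "z \<in> upper_half_plane"
  shows E2_eq_eval_fps: "E2 z = eval_fps E2_fps (nome z)"
    and E4_eq_eval_fps: "E4 z = eval_fps E4_fps (nome z)"
  unfolding E2_def E4_def E2_fps_def E4_fps_def
  using in_conv_radius_nome[OF assms fps_conv_radius_sigma]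
    in_conv_radius_nome[OF assms fps_conv_radius_numeral_mult_sigma]
  by (simp_all add: eval_fps_diff eval_fps_add eval_fps_mult eval_sigma_fps_nome[OF assms])

lemma open_upper_half_plane: "open upper_half_plane"
  unfolding upper_half_plane_def by (rule open_halfspace_Im_gt)

lemma connected_upper_half_plane: "connected upper_half_plane"
  unfolding upper_half_plane_def by (intro convex_connected convex_halfspace_Im_gt)

text \<open>Chain rule: the derivative of \<open>nome\<close> contributes a factor
  \<open>nome z\<close>, which turns \<open>fps_deriv\<close> into \<open>fps_XD\<close>.\<close>

lemma has_field_derivative_eval_fps_nome:
  assumes "z \<in> upper_half_plane" "fps_conv_radius f \<ge> 1"
  shows "((\<lambda>z. eval_fps f (nome z)) has_field_derivative
           2 * of_real pi * \<i> * eval_fps (fps_XD f) (nome z)) (at z)"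
proof -
  note r = in_conv_radius_nome[OF assms]
  have "(nome has_field_derivative 2 * of_real pi * \<i> * nome z) (at z)"
    unfolding nome_def by (auto intro!: derivative_eq_intros)
  from DERIV_chain2[OF has_field_derivative_eval_fps[OF r] this]
  have "((\<lambda>z. eval_fps f (nome z)) has_field_derivative
      eval_fps (fps_deriv f) (nome z) * (2 * of_real pi * \<i> * nome z)) (at z)" .
  moreover have "eval_fps (fps_XD f) (nome z) = nome z * eval_fps (fps_deriv f) (nome z)"
    unfolding fps_XD_def o_def
    using less_le_trans[OF r fps_conv_radius_deriv] by (subst eval_fps_mult) simp_all
  ultimately show ?thesis by (simp add: mult_ac)
qed

text \<open>Agreement with the series on the open half-plane is enough. The constant
  \<open>c\<close> collects the powers of \<open>2 * pi * \<i>\<close> when derivatives are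
  iterated.\<close>

lemma has_field_derivative_upper_half_plane:
  assumes "z \<in> upper_half_plane" "fps_conv_radius f \<ge> 1"
    and "\<And>w. w \<in> upper_half_plane \<Longrightarrow> g w = c * eval_fps f (nome w)"
  shows "(g has_field_derivative c * (2 * of_real pi * \<i> * eval_fps (fps_XD f) (nome z))) (at z)"
  by (rule has_field_derivative_transform_within_open[OF _ open_upper_half_plane assms(1)])
     (use has_field_derivative_eval_fps_nome[OF assms(1,2)] assms(3)
      in \<open>auto intro!: DERIV_cmult\<close>)

section \<open>The zeros of the derivative of \<open>E4\<close> are isolated\<close>

lemma fps_XD_E4_neq_0: "fps_XD (E4_fps :: complex fps) \<noteq> 0"
proof
  assume "fps_XD (E4_fps :: complex fps) = 0"
  hence "fps_nth (fps_XD (E4_fps :: complex fps)) 1 = 0" by simp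
  thus False by (simp add: E4_fps_def divisor_sum_def)
qed

lemma nome_surj:
  assumes "q \<noteq> 0" "norm q < 1"
  obtains z where "z \<in> upper_half_plane" "nome z = q"
proof
  show "Ln q / (2 * of_real pi * \<i>) \<in> upper_half_plane"
    using assms by (simp add: upper_half_plane_def Im_divide power2_eq_square divide_neg_pos)
  show "nome (Ln q / (2 * of_real pi * \<i>)) = q"
    using assms by (simp add: nome_def)
qed

text \<open>The nome covers the punctured unit disc but omits 0; continuity supplies the value at 0,
  and uniqueness of power series finishes.\<close>

lemma eval_fps_nome_eq_0_imp:
  fixes f :: "complex fps"
  assumes "fps_conv_radius f \<ge> 1" and "\<And>z. z \<in> upper_half_plane \<Longrightarrow> eval_fps f (nome z) = 0"
  shows "f = 0"
proof (rule eval_fps_eqD)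
  have pos: "fps_conv_radius f > 0"
    using assms(1) by (rule less_le_trans[rotated]) simp
  show "fps_conv_radius f > 0" "fps_conv_radius (0 :: complex fps) > 0" using pos by simp_all
  have at: "eventually (\<lambda>q. eval_fps f q = 0) (at 0)"
    unfolding eventually_at by (rule exI[of _ 1]) (auto elim!: nome_surj simp: assms(2))
  have "isCont (eval_fps f) 0"
    using pos by (intro continuous_eval_fps) (simp add: zero_ereal_def)
  hence "(eval_fps f \<longlongrightarrow> eval_fps f 0) (at 0)" by (simp add: isCont_def)
  moreover have "(eval_fps f \<longlongrightarrow> 0) (at 0)"
    using at by (rule tendsto_eventually)
  ultimately have "eval_fps f 0 = 0"
    by (rule tendsto_unique[rotated]) simp
  with at show "eventually (\<lambda>q. eval_fps f q = eval_fps 0 q) (nhds 0)"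
    by (simp add: eventually_nhds_conv_at)
qed

text \<open>Accumulating zeros would force the pullback to vanish on the connected half-plane by the
  identity theorem, hence \<open>f = 0\<close>.\<close>

lemma eval_fps_nome_neq_0_cosparse:
  fixes f :: "complex fps"
  assumes "fps_conv_radius f \<ge> 1" "f \<noteq> 0"
  shows "\<forall>\<^sub>\<approx>z\<in>upper_half_plane. eval_fps f (nome z) \<noteq> 0"
  unfolding eventually_cosparse_open_eq[OF open_upper_half_plane]
proof
  fix z assume z: "z \<in> upper_half_plane"
  have hol: "(\<lambda>z. eval_fps f (nome z)) holomorphic_on upper_half_plane"
    using has_field_derivative_eval_fps_nome[OF _ assms(1)] open_upper_half_plane
    by (auto simp: holomorphic_on_open)
  show "eventually (\<lambda>w. eval_fps f (nome w) \<noteq> 0) (at z)"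
  proof (rule ccontr)
    let ?U = "{w \<in> upper_half_plane. eval_fps f (nome w) = 0}"
    assume "\<not> ?thesis"
    hence "\<exists>\<^sub>F w in at z. eval_fps f (nome w) = 0"
      by (simp add: frequently_def)
    hence "\<exists>\<^sub>F w in at z. w \<in> ?U"
      using eventually_at_in_open'[OF open_upper_half_plane z]
      by (auto elim: frequently_rev_mp eventually_mono)
    hence "z islimpt ?U" by (simp add: islimpt_conv_frequently_at)
    hence "eval_fps f (nome w) = 0" if "w \<in> upper_half_plane" for w
      by (intro analytic_continuation[OF hol open_upper_half_plane connected_upper_half_plane _ z _ _ that])
        auto
    with assms show False using eval_fps_nome_eq_0_imp by blast
  qed
qed

section \<open>Assembling the Riccati equation\<close>

theorem corollary5p3:
  shows "riccati_u meromorphic_on upper_half_plane \<and>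
    (\<forall>\<^sub>\<approx>z\<in>upper_half_plane.
       1 / (\<i> * of_real pi) * deriv riccati_u z + (riccati_u z)\<^sup>2 = E4 z)"
proof
  \<comment> \<open>On pulled-back series, differentiation in \<open>z\<close> is \<open>a\<close>
    times \<open>fps_XD\<close>, and \<open>1 / (\<i> * pi)\<close> is \<open>2 / a\<close>.\<close>
  define a :: complex where "a = 2 * of_real pi * \<i>"
  let ?ev = "\<lambda>f z. eval_fps f (nome z) :: complex"
  define P where "P = ?ev E2_fps"
  define p where "p = ?ev (fps_XD E2_fps)"
  define Q where "Q = ?ev E4_fps"
  define q where "q = ?ev (fps_XD E4_fps)"
  define q2 where "q2 = ?ev (fps_XD (fps_XD E4_fps))"
  define q3 where "q3 = ?ev (fps_XD (fps_XD (fps_XD E4_fps)))"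
  note defs = P_def p_def Q_def q_def q2_def q3_def
  let ?H = upper_half_plane
  note rad = order_trans[OF _ fps_conv_radius_fps_XD]
  note radE2 = fps_conv_radius_E2_E4(1) rad[OF fps_conv_radius_E2_E4(1)]
  note radE4 = fps_conv_radius_E2_E4(2) rad[OF fps_conv_radius_E2_E4(2)]
    rad[OF rad[OF fps_conv_radius_E2_E4(2)]] rad[OF rad[OF rad[OF fps_conv_radius_E2_E4(2)]]]
  have a: "a \<noteq> 0" by (simp add: a_def)
  have E2: "(E2 has_field_derivative a * p z) (at z)" if "z \<in> ?H" for z
    using has_field_derivative_upper_half_plane[OF that radE2(1), of E2 1]
    by (simp add: E2_eq_eval_fps defs a_def)
  have E4: "(E4 has_field_derivative a * q z) (at z)" if "z \<in> ?H" for z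
    using has_field_derivative_upper_half_plane[OF that radE4(1), of E4 1]
    by (simp add: E4_eq_eval_fps defs a_def)
  have dE4: "deriv E4 z = a * q z" if "z \<in> ?H" for z
    using E4[OF that] by (rule DERIV_imp_deriv)
  have E4': "(deriv E4 has_field_derivative a * (a * q2 z)) (at z)" if "z \<in> ?H" for z
    using has_field_derivative_upper_half_plane[OF that radE4(2), of "deriv E4" a] dE4
    by (simp add: defs a_def)
  have ddE4: "deriv (deriv E4) z = a ^ 2 * q2 z" if "z \<in> ?H" for z
    using DERIV_imp_deriv[OF E4'[OF that]] by (simp add: power2_eq_square)
  have E4'': "(deriv (deriv E4) has_field_derivative a ^ 2 * (a * q3 z)) (at z)" if "z \<in> ?H" for z
    using has_field_derivative_upper_half_plane[OF that radE4(3), of "deriv (deriv E4)" "a ^ 2"]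
      ddE4
    by (simp add: defs a_def)
  have "E2 holomorphic_on ?H" "E4 holomorphic_on ?H"
    using E2 E4 open_upper_half_plane by (auto simp: holomorphic_on_open)
  hence "E2 analytic_on ?H" "E4 analytic_on ?H"
    by (simp_all add: analytic_on_open open_upper_half_plane)
  hence "E2 meromorphic_on ?H" "E4 meromorphic_on ?H"
    by (simp_all add: analytic_on_imp_meromorphic_on)
  thus "riccati_u meromorphic_on ?H"
    unfolding riccati_u_def [abs_def] by (intro meromorphic_intros)

  \<comment> \<open>The zeros of \<open>q\<close> in the half-plane are those of
    \<open>deriv E4\<close>, where \<open>riccati_u\<close> has a default value; the equation is
    proved away from them.\<close>
  have "\<forall>\<^sub>\<approx>z\<in>?H. q z \<noteq> 0"
    unfolding q_def by (intro eval_fps_nome_neq_0_cosparse radE4 fps_XD_E4_neq_0)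
  moreover have "\<forall>\<^sub>\<approx>z\<in>?H. z \<in> ?H"
    by (simp add: eventually_cosparse_open_eq open_upper_half_plane eventually_at_in_open')
  ultimately show "\<forall>\<^sub>\<approx>z\<in>?H. 1 / (\<i> * of_real pi) * deriv riccati_u z + (riccati_u z)\<^sup>2 = E4 z"
  proof eventually_elim
    case (elim z)
    hence z: "z \<in> ?H" and q: "q z \<noteq> 0" by simp_all
    have c: "1 / (\<i> * of_real pi) = 2 / a" by (simp add: a_def)
    have "(riccati_u has_field_derivative
        2 / a * ((a ^ 2 * (a * q3 z) * (a * q z)
            - a ^ 2 * q2 z * (a * (a * q2 z))) / (a * q z * (a * q z)))
        - a * p z) (at z)"
      unfolding riccati_u_def [abs_def] c
      using DERIV_diff[OF DERIV_cmult[OF DERIV_divide[OF E4''[OF z] E4'[OF z]], of "2 / a"] E2[OF z]]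
        z q a
      by (simp add: dE4 ddE4)
    \<comment> \<open>All powers of \<open>a\<close> cancel, so the rest is an identity between
      values of series.\<close>
    hence du: "2 / a * deriv riccati_u z = 4 * (q3 z * q z - q2 z ^ 2) / q z ^ 2 - 2 * p z"
      using a q by (subst DERIV_imp_deriv) (assumption, simp add: field_simps power2_eq_square)
    have u: "riccati_u z = 2 * q2 z / q z - P z"
      unfolding riccati_u_def c dE4[OF z] ddE4[OF z] E2_eq_eval_fps[OF z] P_def
      using a q by (simp add: field_simps power2_eq_square)
    have r: "ereal (norm (nome z)) < fps_conv_radius f" if "fps_conv_radius f \<ge> 1"
        for f :: "complex fps"
      using in_conv_radius_nome[OF z that] .
    have rm: "ereal (norm (nome z)) < fps_conv_radius (f * g)"
      if "ereal (norm (nome z)) < fps_conv_radius f" "ereal (norm (nome z)) < fps_conv_radius g"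
      for f g :: "complex fps"
      using that by (intro less_le_trans[OF _ fps_conv_radius_mult]) simp
    \<comment> \<open>Evaluation is multiplicative only inside both radii of convergence;
      \<open>rm\<close> supplies this for nested products.\<close>
    note ev = eval_fps_mult eval_fps_add eval_fps_diff rm radE2[THEN r] radE4[THEN r]
    have R: "12 * p z = P z ^ 2 - Q z"
      using arg_cong[OF Ramanujan_E2, of "\<lambda>f. eval_fps f (nome z)"]
      by (simp add: ev defs power2_eq_square)
    have ode: "2 * q3 z + 5 * p z * q z = 2 * P z * q2 z"
      using arg_cong[OF E4_third_order_ode, of "\<lambda>f. eval_fps f (nome z)"]
      by (simp add: ev defs)
    \<comment> \<open>The \<open>q2 z ^ 2\<close> terms cancel. Substituting \<open>2 * q z\<close>
      times \<open>ode\<close> leaves \<open>(P z ^ 2 - 12 * p z) * q z ^ 2\<close>, and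
      \<open>R\<close> identifies the bracket with \<open>Q z\<close>.\<close>
    have "4 * (q3 z * q z - q2 z ^ 2) - 2 * p z * q z ^ 2 + (2 * q2 z - P z * q z) ^ 2 =
        Q z * q z ^ 2"
      using R ode by algebra
    moreover have "(2 * q2 z / q z - P z) ^ 2 = (2 * q2 z - P z * q z) ^ 2 / q z ^ 2"
      using q by (simp add: diff_divide_distrib flip: power_divide)
    ultimately have "4 * (q3 z * q z - q2 z ^ 2) / q z ^ 2 - 2 * p z + (2 * q2 z / q z - P z) ^ 2 =
        Q z"
      using q by (simp add: divide_simps algebra_simps)
    thus ?case unfolding c du u E4_eq_eval_fps[OF z] Q_def .
  qed
qed

end
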